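(* Let $\mathcal C$ be a triangulated category and let $(\mathcal D,\mathcal T)$ be an $n$-tilting pair of $t$-structures on $\mathcal C$. Then $\mathcal T$ is left $\mathcal D$-compatible if and only if $n=0$ or $n=1$.
   Context: Full subcategories are closed under isomorphisms and additive. For a $t$-structure $\mathcal D=(\mathcal D^{\le 0},\mathcal D^{\ge 0})$ on $\mathcal C$ put $\mathcal D^{\le i}:=\mathcal D^{\le 0}[-i]$, $\mathcal D^{\ge i}:=\mathcal D^{\ge 0}[-i]$; $\mathcal H_{\mathcal D}=\mathcal D^{\le 0}\cap\mathcal D^{\ge 0}$ is the heart; $\delta^{\le i}$ denotes the truncation functor of $\mathcal D$ (right adjoint to the inclusion $\mathcal D^{\le i}\subseteq\mathcal C$). All $t$-structures considered are non-degenerate: $\bigcap_i\mathcal D^{\le i}=0=\bigcap_i\mathcal D^{\ge i}$. $(\mathcal D,\mathcal T)$ is of type $(n,k)$ if $k\in\mathbb Z$ is maximal with $\mathcal T^{\le k}\subseteq\mathcal D^{\le 0}$ and $n\in\mathbb N$ is minimal with $\mathcal D^{\le -n}\subseteq\mathcal T^{\le k}$. It is right filterable if for every $i\in\mathbb Z$ the class $\mathcal D^{\ge i}\cap\mathcal T^{\ge 0}$ is the co-aisle of a $t$-structure; left filterable if for every $i\in\mathbb Z$ the class $\mathcal D^{\le i}\cap\mathcal T^{\le 0}$ is the aisle of a $t$-structure; filterable if it is right or left filterable. The pair $(\mathcal D,\mathcal T)$ is $n$-tilting if it is filterable of type $(n,0)$ and the full subcategory $\mathcal H_{\mathcal D}\cap\mathcal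 H_{\mathcal T}$ of $\mathcal H_{\mathcal D}$ cogenerates $\mathcal H_{\mathcal D}$, i.e. every object of $\mathcal H_{\mathcal D}$ embeds (in $\mathcal H_{\mathcal D}$) in an object of $\mathcal H_{\mathcal D}\cap\mathcal H_{\mathcal T}$. $\mathcal T$ is left $\mathcal D$-compatible if $\delta^{\le i}(\mathcal T^{\le 0})\subseteq\mathcal T^{\le 0}$ for every $i\in\mathbb Z$. *)

theory Defs
  imports "HOL-Algebra.Group"
begin

section \<open>Categories\<close>

record ('o, 'm) category =
  Obj :: "'o set"
  Arr :: "'m set"
  Dom :: "'m \<Rightarrow> 'o"
  Cod :: "'m \<Rightarrow> 'o"
  Ident :: "'o \<Rightarrow> 'm"
  Comp :: "'m \<Rightarrow> 'm \<Rightarrow> 'm" (infixl \<open>\<cdot>\<index>\<close> 70)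

definition hom_set :: "('o, 'm, 'z) category_scheme \<Rightarrow> 'o \<Rightarrow> 'o \<Rightarrow> 'm set" where
  "hom_set C X Y = {f \<in> Arr C. Dom C f = X \<and> Cod C f = Y}"

text \<open>Composition is written in the order of functions: \<open>g \<cdot> f\<close> is \<open>f\<close> followed by \<open>g\<close>.\<close>

locale category =
  fixes C :: "('o, 'm, 'z) category_scheme" (structure)
  assumes dom_closed: "f \<in> Arr C \<Longrightarrow> Dom C f \<in> Obj C"
    and cod_closed: "f \<in> Arr C \<Longrightarrow> Cod C f \<in> Obj C"
    and ident_closed: "X \<in> Obj C \<Longrightarrow> Ident C X \<in> hom_set C X X"
    and comp_closed: "\<lbrakk>f \<in> hom_set C X Y; g \<in> hom_set C Y Z\<rbrakk> \<Longrightarrow> g \<cdot> f \<in> hom_set C X Z"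
    and comp_assoc: "\<lbrakk>f \<in> hom_set C W X; g \<in> hom_set C X Y; h \<in> hom_set C Y Z\<rbrakk>
        \<Longrightarrow> (h \<cdot> g) \<cdot> f = h \<cdot> (g \<cdot> f)"
    and ident_right: "f \<in> hom_set C X Y \<Longrightarrow> f \<cdot> Ident C X = f"
    and ident_left: "f \<in> hom_set C X Y \<Longrightarrow> Ident C Y \<cdot> f = f"

definition iso_arr :: "('o, 'm, 'z) category_scheme \<Rightarrow> 'o \<Rightarrow> 'o \<Rightarrow> 'm \<Rightarrow> bool" where
  "iso_arr C X Y f \<longleftrightarrow> f \<in> hom_set C X Y \<and>
     (\<exists>g \<in> hom_set C Y X. g \<cdot>\<^bsub>C\<^esub> f = Ident C X \<and> f \<cdot>\<^bsub>C\<^esub> g = Ident C Y)"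

definition zero_object :: "('o, 'm, 'z) category_scheme \<Rightarrow> 'o \<Rightarrow> bool" where
  "zero_object C Z \<longleftrightarrow> Z \<in> Obj C \<and>
     (\<forall>X \<in> Obj C. (\<exists>!f. f \<in> hom_set C Z X) \<and> (\<exists>!f. f \<in> hom_set C X Z))"

text \<open>Full subcategories are given by their sets of objects.  The next two notions concern
  the full subcategory on \<open>S\<close>.\<close>

definition mono_in :: "('o, 'm, 'z) category_scheme \<Rightarrow> 'o set \<Rightarrow> 'o \<Rightarrow> 'o \<Rightarrow> 'm \<Rightarrow> bool" where
  "mono_in C S X Y f \<longleftrightarrow> X \<in> S \<and> Y \<in> S \<and> f \<in> hom_set C X Y \<and>
     (\<forall>W \<in> S. \<forall>g \<in> hom_set C W X. \<forall>h \<in> hom_set C W X. f \<cdot>\<^bsub>C\<^esub> g = f \<cdot>\<^bsub>C\<^esub> h \<longrightarrow> g = h)"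

definition cogenerates :: "('o, 'm, 'z) category_scheme \<Rightarrow> 'o set \<Rightarrow> 'o set \<Rightarrow> bool" where
  "cogenerates C G S \<longleftrightarrow> (\<forall>X \<in> S. \<exists>Y \<in> G. \<exists>f. mono_in C S X Y f)"

text \<open>The functor with object map \<open>Fo\<close> and arrow map \<open>Fm\<close> from \<open>C\<close> to the full subcategory
  on \<open>S\<close> is right adjoint to the inclusion, with counit \<open>\<epsilon>\<close>: postcomposition with
  \<open>\<epsilon> X\<close> is the adjunction bijection \<open>Hom(B, F X) \<cong> Hom(B, X)\<close>, whose naturality in \<open>B\<close> is
  associativity and whose naturality in \<open>X\<close> is that of \<open>\<epsilon>\<close>.\<close>

definition right_adjoint_incl ::
  "('o, 'm, 'z) category_scheme \<Rightarrow> 'o set \<Rightarrow> ('o \<Rightarrow> 'o) \<Rightarrow> ('m \<Rightarrow> 'm) \<Rightarrow> ('o \<Rightarrow> 'm) \<Rightarrow> bool" where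
  "right_adjoint_incl C S Fo Fm \<epsilon> \<longleftrightarrow>
     (\<forall>X \<in> Obj C. Fo X \<in> S) \<and>
     (\<forall>X Y. \<forall>f \<in> hom_set C X Y. Fm f \<in> hom_set C (Fo X) (Fo Y)) \<and>
     (\<forall>X \<in> Obj C. Fm (Ident C X) = Ident C (Fo X)) \<and>
     (\<forall>X Y Z. \<forall>f \<in> hom_set C X Y. \<forall>g \<in> hom_set C Y Z.
        Fm (g \<cdot>\<^bsub>C\<^esub> f) = Fm g \<cdot>\<^bsub>C\<^esub> Fm f) \<and>
     (\<forall>X \<in> Obj C. \<epsilon> X \<in> hom_set C (Fo X) X) \<and>
     (\<forall>X Y. \<forall>f \<in> hom_set C X Y. f \<cdot>\<^bsub>C\<^esub> \<epsilon> X = \<epsilon> Y \<cdot>\<^bsub>C\<^esub> Fm f) \<and>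
     (\<forall>B \<in> S. \<forall>X \<in> Obj C.
        bij_betw (\<lambda>g. \<epsilon> X \<cdot>\<^bsub>C\<^esub> g) (hom_set C B (Fo X)) (hom_set C B X))"


section \<open>Additive categories\<close>

record ('o, 'm) preadditive_category = "('o, 'm) category" +
  Zero :: "'o \<Rightarrow> 'o \<Rightarrow> 'm"
  Add :: "'m \<Rightarrow> 'm \<Rightarrow> 'm" (infixl \<open>\<boxplus>\<index>\<close> 65)

text \<open>Abelian groups are commutative groups in the multiplicative notation of the library.\<close>

definition hom_group ::
  "('o, 'm, 'z) preadditive_category_scheme \<Rightarrow> 'o \<Rightarrow> 'o \<Rightarrow> 'm monoid" where
  "hom_group C X Y = \<lparr>carrier = hom_set C X Y, mult = Add C, one = Zero C X Y\<rparr>"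

definition neg :: "('o, 'm, 'z) preadditive_category_scheme \<Rightarrow> 'm \<Rightarrow> 'm" where
  "neg C f = m_inv (hom_group C (Dom C f) (Cod C f)) f"

locale preadditive_category = category C
  for C :: "('o, 'm, 'z) preadditive_category_scheme" (structure) +
  assumes hom_comm_group: "\<lbrakk>X \<in> Obj C; Y \<in> Obj C\<rbrakk> \<Longrightarrow> comm_group (hom_group C X Y)"
    and comp_add_right: "\<lbrakk>f \<in> hom_set C X Y; f' \<in> hom_set C X Y; g \<in> hom_set C Y Z\<rbrakk>
        \<Longrightarrow> g \<cdot> (f \<boxplus> f') = (g \<cdot> f) \<boxplus> (g \<cdot> f')"
    and comp_add_left: "\<lbrakk>f \<in> hom_set C X Y; g \<in> hom_set C Y Z; g' \<in> hom_set C Y Z\<rbrakk>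
        \<Longrightarrow> (g \<boxplus> g') \<cdot> f = (g \<cdot> f) \<boxplus> (g' \<cdot> f)"

definition direct_sum ::
  "('o, 'm, 'z) preadditive_category_scheme \<Rightarrow> 'o \<Rightarrow> 'o \<Rightarrow> 'o \<Rightarrow> bool" where
  "direct_sum C X Y S \<longleftrightarrow>
     (\<exists>i \<in> hom_set C X S. \<exists>j \<in> hom_set C Y S. \<exists>p \<in> hom_set C S X. \<exists>q \<in> hom_set C S Y.
        p \<cdot>\<^bsub>C\<^esub> i = Ident C X \<and> q \<cdot>\<^bsub>C\<^esub> j = Ident C Y \<and>
        q \<cdot>\<^bsub>C\<^esub> i = Zero C X Y \<and> p \<cdot>\<^bsub>C\<^esub> j = Zero C Y X \<and>
        (i \<cdot>\<^bsub>C\<^esub> p) \<boxplus>\<^bsub>C\<^esub> (j \<cdot>\<^bsub>C\<^esub> q) = Ident C S)"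

locale additive_category = preadditive_category C
  for C :: "('o, 'm, 'z) preadditive_category_scheme" (structure) +
  assumes ex_zero_object: "\<exists>Z. zero_object C Z"
    and ex_direct_sum: "\<lbrakk>X \<in> Obj C; Y \<in> Obj C\<rbrakk> \<Longrightarrow> \<exists>S. direct_sum C X Y S"

text \<open>Full additive subcategories closed under isomorphisms.\<close>

definition additive_subcat ::
  "('o, 'm, 'z) preadditive_category_scheme \<Rightarrow> 'o set \<Rightarrow> bool" where
  "additive_subcat C S \<longleftrightarrow> S \<subseteq> Obj C \<and>
     (\<forall>X \<in> S. \<forall>Y f. iso_arr C X Y f \<longrightarrow> Y \<in> S) \<and>
     (\<forall>Z. zero_object C Z \<longrightarrow> Z \<in> S) \<and>
     (\<forall>X \<in> S. \<forall>Y \<in> S. \<forall>W. direct_sum C X Y W \<longrightarrow> W \<in> S)"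


section \<open>Triangulated categories\<close>

text \<open>The shift functor is an automorphism, given by all its integer powers
  \<open>X \<mapsto> X[i]\<close> (\<open>ShO\<close> on objects, \<open>ShA\<close> on arrows).  A distinguished triangle
  \<open>X \<rightarrow> Y \<rightarrow> Z \<rightarrow> X[1]\<close> is recorded as the triple of its arrows, which determine the
  objects.\<close>

record ('o, 'm) triangulated_category = "('o, 'm) preadditive_category" +
  ShO :: "int \<Rightarrow> 'o \<Rightarrow> 'o"
  ShA :: "int \<Rightarrow> 'm \<Rightarrow> 'm"
  Dist :: "('m \<times> 'm \<times> 'm) set"

definition triangle :: "('o, 'm, 'z) triangulated_category_scheme
    \<Rightarrow> 'o \<Rightarrow> 'o \<Rightarrow> 'o \<Rightarrow> 'm \<Rightarrow> 'm \<Rightarrow> 'm \<Rightarrow> bool" where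
  "triangle C X Y Z f g h \<longleftrightarrow>
     f \<in> hom_set C X Y \<and> g \<in> hom_set C Y Z \<and> h \<in> hom_set C Z (ShO C 1 X)"

definition dist_triangle :: "('o, 'm, 'z) triangulated_category_scheme
    \<Rightarrow> 'o \<Rightarrow> 'o \<Rightarrow> 'o \<Rightarrow> 'm \<Rightarrow> 'm \<Rightarrow> 'm \<Rightarrow> bool" where
  "dist_triangle C X Y Z f g h \<longleftrightarrow> triangle C X Y Z f g h \<and> (f, g, h) \<in> Dist C"

definition triangle_morphism :: "('o, 'm, 'z) triangulated_category_scheme
    \<Rightarrow> 'm \<times> 'm \<times> 'm \<Rightarrow> 'm \<times> 'm \<times> 'm \<Rightarrow> 'm \<Rightarrow> 'm \<Rightarrow> 'm \<Rightarrow> bool" where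
  "triangle_morphism C = (\<lambda>(f, g, h) (f', g', h') a b c.
     b \<cdot>\<^bsub>C\<^esub> f = f' \<cdot>\<^bsub>C\<^esub> a \<and> c \<cdot>\<^bsub>C\<^esub> g = g' \<cdot>\<^bsub>C\<^esub> b \<and> ShA C 1 a \<cdot>\<^bsub>C\<^esub> h = h' \<cdot>\<^bsub>C\<^esub> c)"

locale triangulated_category = additive_category C
  for C :: "('o, 'm, 'z) triangulated_category_scheme" (structure) +
  assumes sh_obj: "X \<in> Obj C \<Longrightarrow> ShO C i X \<in> Obj C"
    and sh_arr: "f \<in> hom_set C X Y \<Longrightarrow> ShA C i f \<in> hom_set C (ShO C i X) (ShO C i Y)"
    and sh_ident: "X \<in> Obj C \<Longrightarrow> ShA C i (Ident C X) = Ident C (ShO C i X)"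
    and sh_comp: "\<lbrakk>f \<in> hom_set C X Y; g \<in> hom_set C Y Z\<rbrakk>
        \<Longrightarrow> ShA C i (g \<cdot> f) = ShA C i g \<cdot> ShA C i f"
    and sh_add: "\<lbrakk>f \<in> hom_set C X Y; g \<in> hom_set C X Y\<rbrakk>
        \<Longrightarrow> ShA C i (f \<boxplus> g) = ShA C i f \<boxplus> ShA C i g"
    and sh_obj_0: "X \<in> Obj C \<Longrightarrow> ShO C 0 X = X"
    and sh_arr_0: "f \<in> Arr C \<Longrightarrow> ShA C 0 f = f"
    and sh_obj_sum: "X \<in> Obj C \<Longrightarrow> ShO C i (ShO C j X) = ShO C (i + j) X"
    and sh_arr_sum: "f \<in> Arr C \<Longrightarrow> ShA C i (ShA C j f) = ShA C (i + j) f"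
    and dist_wf: "(f, g, h) \<in> Dist C \<Longrightarrow> \<exists>X Y Z. triangle C X Y Z f g h"
    and TR1_ident: "\<lbrakk>X \<in> Obj C; zero_object C Z\<rbrakk>
        \<Longrightarrow> dist_triangle C X X Z (Ident C X) (Zero C X Z) (Zero C Z (ShO C 1 X))"
    and TR1_cone: "f \<in> hom_set C X Y \<Longrightarrow> \<exists>Z g h. dist_triangle C X Y Z f g h"
    and TR1_iso: "\<lbrakk>dist_triangle C X Y Z f g h; triangle C X' Y' Z' f' g' h';
         iso_arr C X X' a; iso_arr C Y Y' b; iso_arr C Z Z' c;
         triangle_morphism C (f, g, h) (f', g', h') a b c\<rbrakk>
        \<Longrightarrow> dist_triangle C X' Y' Z' f' g' h'"
    and TR2: "triangle C X Y Z f g h \<Longrightarrow>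
         dist_triangle C X Y Z f g h \<longleftrightarrow>
         dist_triangle C Y Z (ShO C 1 X) g h (neg C (ShA C 1 f))"
    and TR3: "\<lbrakk>dist_triangle C X Y Z f g h; dist_triangle C X' Y' Z' f' g' h';
         a \<in> hom_set C X X'; b \<in> hom_set C Y Y'; b \<cdot> f = f' \<cdot> a\<rbrakk>
        \<Longrightarrow> \<exists>c \<in> hom_set C Z Z'. triangle_morphism C (f, g, h) (f', g', h') a b c"
    and TR4: "\<lbrakk>f \<in> hom_set C X Y; g \<in> hom_set C Y Z;
         dist_triangle C X Y Q\<^sub>1 f p\<^sub>1 d\<^sub>1;
         dist_triangle C X Z Q\<^sub>2 (g \<cdot> f) p\<^sub>2 d\<^sub>2;
         dist_triangle C Y Z Q\<^sub>3 g p\<^sub>3 d\<^sub>3\<rbrakk>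
        \<Longrightarrow> \<exists>u v. dist_triangle C Q\<^sub>1 Q\<^sub>2 Q\<^sub>3 u v (ShA C 1 p\<^sub>1 \<cdot> d\<^sub>3) \<and>
              triangle_morphism C (f, p\<^sub>1, d\<^sub>1) (g \<cdot> f, p\<^sub>2, d\<^sub>2) (Ident C X) g u \<and>
              triangle_morphism C (g \<cdot> f, p\<^sub>2, d\<^sub>2) (g, p\<^sub>3, d\<^sub>3) f (Ident C Z) v"


section \<open>t-structures\<close>

text \<open>A pair \<open>D\<close> of sets of objects stands for \<open>(D\<^sup>\<le>\<^sup>0, D\<^sup>\<ge>\<^sup>0)\<close>; \<open>le C D i\<close> and \<open>ge C D i\<close> are
  \<open>D\<^sup>\<le>\<^sup>i\<close> and \<open>D\<^sup>\<ge>\<^sup>i\<close>.\<close>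

type_synonym 'o tpair = "'o set \<times> 'o set"

definition le ::
  "('o, 'm, 'z) triangulated_category_scheme \<Rightarrow> 'o tpair \<Rightarrow> int \<Rightarrow> 'o set" where
  "le C D i = ShO C (- i) ` fst D"

definition ge ::
  "('o, 'm, 'z) triangulated_category_scheme \<Rightarrow> 'o tpair \<Rightarrow> int \<Rightarrow> 'o set" where
  "ge C D i = ShO C (- i) ` snd D"

definition nondegenerate ::
  "('o, 'm, 'z) triangulated_category_scheme \<Rightarrow> 'o tpair \<Rightarrow> bool" where
  "nondegenerate C D \<longleftrightarrow>
     (\<Inter>i. le C D i) = {Z. zero_object C Z} \<and> (\<Inter>i. ge C D i) = {Z. zero_object C Z}"

text \<open>All t-structures are required to be non-degenerate.\<close>

definition t_structure ::
  "('o, 'm, 'z) triangulated_category_scheme \<Rightarrow> 'o tpair \<Rightarrow> bool" where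
  "t_structure C D \<longleftrightarrow>
     additive_subcat C (fst D) \<and> additive_subcat C (snd D) \<and>
     (\<forall>X \<in> le C D 0. \<forall>Y \<in> ge C D 1. hom_set C X Y = {Zero C X Y}) \<and>
     le C D 0 \<subseteq> le C D 1 \<and> ge C D 1 \<subseteq> ge C D 0 \<and>
     (\<forall>X \<in> Obj C. \<exists>A \<in> le C D 0. \<exists>B \<in> ge C D 1. \<exists>f g h. dist_triangle C A X B f g h) \<and>
     nondegenerate C D"

definition heart ::
  "('o, 'm, 'z) triangulated_category_scheme \<Rightarrow> 'o tpair \<Rightarrow> 'o set" where
  "heart C D = le C D 0 \<inter> ge C D 0"

definition of_type ::
  "('o, 'm, 'z) triangulated_category_scheme \<Rightarrow> 'o tpair \<Rightarrow> 'o tpair \<Rightarrow> nat \<Rightarrow> int \<Rightarrow> bool" where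
  "of_type C D T n k \<longleftrightarrow>
     le C T k \<subseteq> le C D 0 \<and> (\<forall>j. le C T j \<subseteq> le C D 0 \<longrightarrow> j \<le> k) \<and>
     le C D (- int n) \<subseteq> le C T k \<and> (\<forall>m. le C D (- int m) \<subseteq> le C T k \<longrightarrow> n \<le> m)"

definition right_filterable ::
  "('o, 'm, 'z) triangulated_category_scheme \<Rightarrow> 'o tpair \<Rightarrow> 'o tpair \<Rightarrow> bool" where
  "right_filterable C D T \<longleftrightarrow>
     (\<forall>i. \<exists>E. t_structure C E \<and> snd E = ge C D i \<inter> ge C T 0)"

definition left_filterable ::
  "('o, 'm, 'z) triangulated_category_scheme \<Rightarrow> 'o tpair \<Rightarrow> 'o tpair \<Rightarrow> bool" where
  "left_filterable C D T \<longleftrightarrow>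
     (\<forall>i. \<exists>E. t_structure C E \<and> fst E = le C D i \<inter> le C T 0)"

definition filterable ::
  "('o, 'm, 'z) triangulated_category_scheme \<Rightarrow> 'o tpair \<Rightarrow> 'o tpair \<Rightarrow> bool" where
  "filterable C D T \<longleftrightarrow> right_filterable C D T \<or> left_filterable C D T"

definition tilting_pair ::
  "('o, 'm, 'z) triangulated_category_scheme \<Rightarrow> nat \<Rightarrow> 'o tpair \<Rightarrow> 'o tpair \<Rightarrow> bool" where
  "tilting_pair C n D T \<longleftrightarrow>
     filterable C D T \<and> of_type C D T n 0 \<and>
     cogenerates C (heart C D \<inter> heart C T) (heart C D)"

text \<open>\<open>(Fo, Fm)\<close> is the truncation functor to \<open>D\<^sup>\<le>\<^sup>i\<close> with counit \<open>\<epsilon>\<close>.  It exists for every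
  t-structure but is only unique up to isomorphism; since \<open>T\<^sup>\<le>\<^sup>0\<close> is closed under
  isomorphisms, compatibility does not depend on the choice.\<close>

definition truncation :: "('o, 'm, 'z) triangulated_category_scheme \<Rightarrow> 'o tpair \<Rightarrow> int
    \<Rightarrow> ('o \<Rightarrow> 'o) \<Rightarrow> ('m \<Rightarrow> 'm) \<Rightarrow> ('o \<Rightarrow> 'm) \<Rightarrow> bool" where
  "truncation C D i Fo Fm \<epsilon> \<longleftrightarrow> right_adjoint_incl C (le C D i) Fo Fm \<epsilon>"

definition left_compatible ::
  "('o, 'm, 'z) triangulated_category_scheme \<Rightarrow> 'o tpair \<Rightarrow> 'o tpair \<Rightarrow> bool" where
  "left_compatible C D T \<longleftrightarrow>
     (\<forall>i Fo Fm \<epsilon>. truncation C D i Fo Fm \<epsilon> \<longrightarrow> Fo ` le C T 0 \<subseteq> le C T 0)"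

end

theory Submission
  imports Defs
begin

text \<open>
  Since the type is \<open>(n, 0)\<close>, we have \<open>D\<^sup>\<le>\<^sup>-\<^sup>n \<subseteq> T\<^sup>\<le>\<^sup>0 \<subseteq> D\<^sup>\<le>\<^sup>0\<close> with \<open>n\<close> minimal, so \<open>n \<le> 1\<close> says exactly that
  \<open>D\<^sup>\<le>\<^sup>-\<^sup>1 \<subseteq> T\<^sup>\<le>\<^sup>0\<close>.

  If this inclusion holds, compatibility is immediate (\<open>left_compatible_if_near\<close>): the truncation
  \<open>\<delta>\<^sup>\<le>\<^sup>i\<close> of an object of \<open>T\<^sup>\<le>\<^sup>0\<close> is isomorphic to that object when \<open>i \<ge> 0\<close>, and it lies in
  \<open>D\<^sup>\<le>\<^sup>-\<^sup>1\<close> when \<open>i < 0\<close>.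

  Conversely, cogeneration presents every \<open>X\<close> in the heart of \<open>D\<close> as the kernel of a morphism
  \<open>Y\<^sub>0 \<rightarrow> Y\<^sub>1\<close> between objects that lie in both hearts: embed \<open>X\<close> in \<open>Y\<^sub>0\<close>, and then the cokernel
  in \<open>Y\<^sub>1\<close>.  The cone \<open>Z\<close> of \<open>Y\<^sub>0 \<rightarrow> Y\<^sub>1\<close> lies in \<open>T\<^sup>\<le>\<^sup>0\<close>, because both objects do.  By the octahedral
  axiom there is a triangle \<open>X[1] \<rightarrow> Z \<rightarrow> E\<close> with \<open>E\<close> in the heart of \<open>D\<close>
  (\<open>shifted_heart_truncates_cone\<close>), so \<open>X[1] = \<delta>\<^sup>\<le>\<^sup>-\<^sup>1 Z\<close>, and compatibility puts \<open>X[1]\<close> in \<open>T\<^sup>\<le>\<^sup>0\<close>.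
  An object of \<open>D\<^sup>\<le>\<^sup>-\<^sup>1\<close> is an iterated extension of shifts \<open>H[j]\<close> of objects of the heart with
  \<open>1 \<le> j < n\<close> and of an object of \<open>D\<^sup>\<le>\<^sup>-\<^sup>n\<close>; all these lie in \<open>T\<^sup>\<le>\<^sup>0\<close>, hence so does the object
  (\<open>le_subset_from_heart\<close>), and minimality gives \<open>n \<le> 1\<close>.

  The remaining work is general theory: exactness of Hom on distinguished triangles, aisles and
  co-aisles as orthogonals of each other, and truncation triangles as coreflections.
\<close>

section \<open>Hom groups and the shift\<close>

context preadditive_category
begin

lemma hom_objs:
  assumes "f \<in> hom_set C X Y"
  shows "X \<in> Obj C" "Y \<in> Obj C"
  using assms dom_closed cod_closed by (auto simp: hom_set_def)

lemma zero_closed: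
  assumes "X \<in> Obj C" "Y \<in> Obj C"
  shows "Zero C X Y \<in> hom_set C X Y"
proof -
  interpret G: comm_group "hom_group C X Y" using hom_comm_group[OF assms] .
  show ?thesis using G.one_closed by (simp add: hom_group_def)
qed

lemma neg_closed:
  assumes f: "f \<in> hom_set C X Y"
  shows "neg C f \<in> hom_set C X Y"
proof -
  interpret G: comm_group "hom_group C X Y" using hom_comm_group[OF hom_objs[OF f]] .
  have "neg C f = inv\<^bsub>hom_group C X Y\<^esub> f" using f by (auto simp: neg_def hom_set_def)
  then show ?thesis using G.inv_closed f by (simp add: hom_group_def)
qed

lemma add_neg:
  assumes f: "f \<in> hom_set C X Y"
  shows "f \<boxplus> neg C f = Zero C X Y"
proof -
  interpret G: comm_group "hom_group C X Y" using hom_comm_group[OF hom_objs[OF f]] .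
  have "neg C f = inv\<^bsub>hom_group C X Y\<^esub> f" using f by (auto simp: neg_def hom_set_def)
  then show ?thesis using G.r_inv[of f] f by (simp add: hom_group_def)
qed

lemma neg_unique:
  assumes f: "f \<in> hom_set C X Y" and g: "g \<in> hom_set C X Y" and "f \<boxplus> g = Zero C X Y"
  shows "g = neg C f"
proof -
  interpret G: comm_group "hom_group C X Y" using hom_comm_group[OF hom_objs[OF f]] .
  show ?thesis
    using G.right_cancel[of f g "neg C f"] assms neg_closed[OF f] add_neg[OF f]
      G.m_comm[of f g] G.m_comm[of f "neg C f"]
    by (simp add: hom_group_def)
qed

lemma add_comm:
  assumes f: "f \<in> hom_set C X Y" and g: "g \<in> hom_set C X Y"
  shows "f \<boxplus> g = g \<boxplus> f"
proof -
  interpret G: comm_group "hom_group C X Y" using hom_comm_group[OF hom_objs[OF f]] .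
  show ?thesis using G.m_comm[of f g] f g by (simp add: hom_group_def)
qed

lemma neg_neg:
  assumes f: "f \<in> hom_set C X Y"
  shows "neg C (neg C f) = f"
  using neg_unique[OF neg_closed[OF f] f] add_comm[OF f neg_closed[OF f]] add_neg[OF f] by simp

lemma eq_if_diff_zero:
  assumes f: "f \<in> hom_set C X Y" and g: "g \<in> hom_set C X Y" and z: "f \<boxplus> neg C g = Zero C X Y"
  shows "f = g"
  using neg_unique[OF neg_closed[OF g] f] add_comm[OF f neg_closed[OF g]] z neg_neg[OF g] by simp

lemma zero_if_idem:
  assumes f: "f \<in> hom_set C X Y" and i: "f \<boxplus> f = f"
  shows "f = Zero C X Y"
proof -
  interpret G: comm_group "hom_group C X Y" using hom_comm_group[OF hom_objs[OF f]] .
  show ?thesis using G.r_cancel_one[of f f] f i by (simp add: hom_group_def)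
qed

lemma zero_add_zero:
  assumes "X \<in> Obj C" "Y \<in> Obj C"
  shows "Zero C X Y \<boxplus> Zero C X Y = Zero C X Y"
proof -
  interpret G: comm_group "hom_group C X Y" using hom_comm_group[OF assms] .
  show ?thesis using G.l_one[OF G.one_closed] by (simp add: hom_group_def)
qed

lemma comp_zero_right:
  assumes X: "X \<in> Obj C" and g: "g \<in> hom_set C Y Z"
  shows "g \<cdot> Zero C X Y = Zero C X Z"
proof -
  note z = zero_closed[OF X hom_objs(1)[OF g]]
  show ?thesis
    using zero_if_idem[OF comp_closed[OF z g]] comp_add_right[OF z z g]
      zero_add_zero[OF X hom_objs(1)[OF g]] by simp
qed

lemma comp_zero_left:
  assumes f: "f \<in> hom_set C X Y" and Z: "Z \<in> Obj C"
  shows "Zero C Y Z \<cdot> f = Zero C X Z"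
proof -
  note z = zero_closed[OF hom_objs(2)[OF f] Z]
  show ?thesis
    using zero_if_idem[OF comp_closed[OF f z]] comp_add_left[OF f z z]
      zero_add_zero[OF hom_objs(2)[OF f] Z] by simp
qed

lemma comp_neg_right:
  assumes f: "f \<in> hom_set C X Y" and g: "g \<in> hom_set C Y Z"
  shows "g \<cdot> neg C f = neg C (g \<cdot> f)"
proof (rule neg_unique[OF comp_closed[OF f g] comp_closed[OF neg_closed[OF f] g]])
  show "(g \<cdot> f) \<boxplus> (g \<cdot> neg C f) = Zero C X Z"
    using comp_add_right[OF f neg_closed[OF f] g] add_neg[OF f]
      comp_zero_right[OF hom_objs(1)[OF f] g] by simp
qed

lemma comp_neg_left:
  assumes f: "f \<in> hom_set C X Y" and g: "g \<in> hom_set C Y Z"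
  shows "neg C g \<cdot> f = neg C (g \<cdot> f)"
proof (rule neg_unique[OF comp_closed[OF f g] comp_closed[OF f neg_closed[OF g]]])
  show "(g \<cdot> f) \<boxplus> (neg C g \<cdot> f) = Zero C X Z"
    using comp_add_left[OF f g neg_closed[OF g]] add_neg[OF g]
      comp_zero_left[OF f hom_objs(2)[OF g]] by simp
qed

lemma neg_zero:
  assumes "X \<in> Obj C" "Y \<in> Obj C"
  shows "neg C (Zero C X Y) = Zero C X Y"
  using neg_unique[OF zero_closed[OF assms] zero_closed[OF assms] zero_add_zero[OF assms]] by simp

lemma zero_object_hom_to:
  assumes "zero_object C Z" and f: "f \<in> hom_set C X Z"
  shows "f = Zero C X Z"
  using assms zero_closed[OF hom_objs[OF f]] hom_objs[OF f] unfolding zero_object_def by blast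

lemma zero_object_if_ident_zero:
  assumes Z: "Z \<in> Obj C" and i: "Ident C Z = Zero C Z Z"
  shows "zero_object C Z"
proof -
  have 1: "f = Zero C Z X" if "f \<in> hom_set C Z X" for f X
    using ident_right[OF that] comp_zero_right[OF Z that] i by simp
  have 2: "f = Zero C X Z" if "f \<in> hom_set C X Z" for f X
    using ident_left[OF that] comp_zero_left[OF that Z] i by simp
  show ?thesis unfolding zero_object_def using Z 1 2 zero_closed by metis
qed

definition orth :: "'o \<Rightarrow> 'o \<Rightarrow> bool" where
  "orth X Y \<longleftrightarrow> (\<forall>f \<in> hom_set C X Y. f = Zero C X Y)"

lemma orthD: "\<lbrakk>orth X Y; f \<in> hom_set C X Y\<rbrakk> \<Longrightarrow> f = Zero C X Y"
  by (simp add: orth_def)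

lemma iso_if_split_both:
  assumes f: "f \<in> hom_set C X Y" and r: "r \<in> hom_set C Y X" and s: "s \<in> hom_set C Y X"
    and rf: "r \<cdot> f = Ident C X" and fs: "f \<cdot> s = Ident C Y"
  shows "iso_arr C X Y f"
proof -
  have "r = s"
    using comp_assoc[OF s f r] rf fs ident_left[OF s] ident_right[OF r] by simp
  then show ?thesis unfolding iso_arr_def using f r rf fs by blast
qed

lemma iso_arr_sym:
  assumes "iso_arr C X Y f" shows "\<exists>g. iso_arr C Y X g"
  using assms unfolding iso_arr_def by blast

end

context triangulated_category
begin

lemma hom_arr: "f \<in> hom_set C X Y \<Longrightarrow> f \<in> Arr C"
  by (simp add: hom_set_def)

lemma sh_zero:
  assumes X: "X \<in> Obj C" and Y: "Y \<in> Obj C"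
  shows "ShA C i (Zero C X Y) = Zero C (ShO C i X) (ShO C i Y)"
proof -
  note z = zero_closed[OF X Y]
  show ?thesis
    using zero_if_idem[OF sh_arr[OF z]] sh_add[OF z z] zero_add_zero[OF X Y] by simp
qed

lemma sh_obj_cancel [simp]:
  "X \<in> Obj C \<Longrightarrow> ShO C (- i) (ShO C i X) = X"
  "X \<in> Obj C \<Longrightarrow> ShO C i (ShO C (- i) X) = X"
  by (simp_all add: sh_obj_sum sh_obj_0)

lemma sh_arr_cancel:
  assumes "f \<in> hom_set C X Y"
  shows "ShA C (- i) (ShA C i f) = f" "ShA C i (ShA C (- i) f) = f"
  using sh_arr_sum[OF hom_arr[OF assms]] sh_arr_0[OF hom_arr[OF assms]] by simp_all

lemma sh_inj:
  assumes "f \<in> hom_set C X Y" "g \<in> hom_set C X Y" "ShA C i f = ShA C i g"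
  shows "f = g"
  using assms sh_arr_cancel(1) by metis

lemma zero_if_sh_zero:
  assumes f: "f \<in> hom_set C X Y" and z: "ShA C i f = Zero C (ShO C i X) (ShO C i Y)"
  shows "f = Zero C X Y"
  using sh_inj[OF f zero_closed[OF hom_objs[OF f]]] z sh_zero[OF hom_objs[OF f]] by simp

lemma sh_down:
  assumes X: "X \<in> Obj C" and Y: "Y \<in> Obj C" and f: "f \<in> hom_set C (ShO C i X) (ShO C i Y)"
  shows "ShA C (- i) f \<in> hom_set C X Y"
  using sh_arr[OF f, of "- i"] X Y by simp

lemma orth_sh:
  assumes X: "X \<in> Obj C" and Y: "Y \<in> Obj C" and o: "orth (ShO C i X) (ShO C i Y)"
  shows "orth X Y"
  unfolding orth_def using zero_if_sh_zero orthD[OF o] sh_arr by blast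

lemma iso_sh:
  assumes "iso_arr C X Y f"
  shows "iso_arr C (ShO C i X) (ShO C i Y) (ShA C i f)"
proof -
  obtain g where f: "f \<in> hom_set C X Y" and g: "g \<in> hom_set C Y X"
    and "g \<cdot> f = Ident C X" "f \<cdot> g = Ident C Y"
    using assms unfolding iso_arr_def by blast
  then show ?thesis
    unfolding iso_arr_def
    using sh_arr[OF f] sh_arr[OF g] sh_comp[OF f g] sh_comp[OF g f] sh_ident hom_objs[OF f]
    by metis
qed


section \<open>Exactness of Hom on distinguished triangles\<close>

lemma dist_homs:
  assumes "dist_triangle C X Y Z f g h"
  shows "f \<in> hom_set C X Y" "g \<in> hom_set C Y Z" "h \<in> hom_set C Z (ShO C 1 X)"
  using assms by (auto simp: dist_triangle_def triangle_def)

lemma dist_objs: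
  assumes "dist_triangle C X Y Z f g h"
  shows "X \<in> Obj C" "Y \<in> Obj C" "Z \<in> Obj C"
  using dist_homs[OF assms] hom_objs by blast+

lemma rotate:
  assumes "dist_triangle C X Y Z f g h"
  shows "dist_triangle C Y Z (ShO C 1 X) g h (neg C (ShA C 1 f))"
  using assms TR2[of X Y Z f g h] unfolding dist_triangle_def by blast

text \<open>The inverse rotation is a rotation read backwards: its first arrow is the desuspension of
  \<open>-h\<close>, chosen so that the sign introduced by TR2 cancels.\<close>

lemma rotate_back:
  assumes d: "dist_triangle C X Y Z f g h"
  shows "\<exists>k. dist_triangle C (ShO C (- 1) Z) X Y k f g"
proof -
  note X = dist_objs(1)[OF d] and Z = dist_objs(3)[OF d] and h = dist_homs(3)[OF d]
  let ?k = "ShA C (- 1) (neg C h)"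
  have k: "?k \<in> hom_set C (ShO C (- 1) Z) X"
    using sh_arr[OF neg_closed[OF h], of "- 1"] X by (simp add: sh_obj_sum sh_obj_0)
  have e: "neg C (ShA C 1 ?k) = h"
    using sh_arr_cancel(2)[OF neg_closed[OF h], of 1] neg_neg[OF h] by simp
  have "triangle C (ShO C (- 1) Z) X Y ?k f g"
    using k dist_homs[OF d] Z by (simp add: triangle_def sh_obj_sum sh_obj_0)
  then have "dist_triangle C (ShO C (- 1) Z) X Y ?k f g"
    using TR2 d e Z by (simp add: sh_obj_sum sh_obj_0)
  then show ?thesis ..
qed

text \<open>Shifting by one is three rotations.  This changes the signs of the arrows, which is why only
  the existence of a triangle on the shifted objects is recorded.\<close>

lemma dist_shift:
  assumes "dist_triangle C X Y Z f g h"
  shows "\<exists>f g h. dist_triangle C (ShO C i X) (ShO C i Y) (ShO C i Z) f g h"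
proof (induction i rule: int_induct[where k = 0])
  case base
  then show ?case using assms dist_objs[OF assms] by (auto simp: sh_obj_0)
next
  case (step1 i)
  then obtain f g h where "dist_triangle C (ShO C i X) (ShO C i Y) (ShO C i Z) f g h" by blast
  from rotate[OF rotate[OF rotate[OF this]]]
  show ?case using dist_objs[OF assms] by (auto simp: sh_obj_sum add.commute)
next
  case (step2 i)
  then obtain f g h where "dist_triangle C (ShO C i X) (ShO C i Y) (ShO C i Z) f g h" by blast
  then obtain h' where "dist_triangle C (ShO C (- 1) (ShO C i Z)) (ShO C i X) (ShO C i Y) h' f g"
    using rotate_back by blast
  then obtain g' where "dist_triangle C (ShO C (- 1) (ShO C i Y)) (ShO C (- 1) (ShO C i Z))
      (ShO C i X) g' h' f"
    using rotate_back by blast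
  then obtain f' where "dist_triangle C (ShO C (- 1) (ShO C i X)) (ShO C (- 1) (ShO C i Y))
      (ShO C (- 1) (ShO C i Z)) f' g' h'"
    using rotate_back by blast
  then show ?case using dist_objs[OF assms] by (auto simp: sh_obj_sum)
qed

text \<open>Map the triangle of \<open>Ident C X\<close> to the given one by \<open>f\<close> in the middle: then \<open>g \<cdot> f\<close> factors
  through a zero object.\<close>

lemma dist_comp_zero:
  assumes d: "dist_triangle C X Y Z f g h"
  shows "g \<cdot> f = Zero C X Z"
proof -
  note X = dist_objs(1)[OF d] and f = dist_homs(1)[OF d] and g = dist_homs(2)[OF d]
  obtain N where N: "zero_object C N" using ex_zero_object by blast
  have "f \<cdot> Ident C X = f \<cdot> Ident C X" ..
  from TR3[OF TR1_ident[OF X N] d ident_closed[OF X] f this]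
  obtain c where c: "c \<in> hom_set C N Z" and "c \<cdot> Zero C X N = g \<cdot> f"
    unfolding triangle_morphism_def by auto
  then show ?thesis using comp_zero_right[OF X c] by simp
qed

text \<open>If \<open>b\<close> is killed by \<open>g\<close>, it is part of a map from the rotated triangle \<open>W \<rightarrow> 0 \<rightarrow> W[1]\<close> to the
  rotation of the given triangle; the third component, desuspended, is the factorization.\<close>

lemma hom_exact_middle:
  assumes d: "dist_triangle C X Y Z f g h"
    and b: "b \<in> hom_set C W Y" and gb: "g \<cdot> b = Zero C W Z"
  shows "\<exists>a \<in> hom_set C W X. f \<cdot> a = b"
proof -
  note X = dist_objs(1)[OF d] and Z = dist_objs(3)[OF d]
    and f = dist_homs(1)[OF d] and W = hom_objs(1)[OF b]
  obtain N where N: "zero_object C N" using ex_zero_object by blast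
  then have N0: "N \<in> Obj C" by (simp add: zero_object_def)
  note w = rotate[OF TR1_ident[OF W N]]
  have "Zero C N Z \<cdot> Zero C W N = g \<cdot> b"
    using gb comp_zero_left[OF zero_closed[OF W N0] Z] by simp
  from TR3[OF w rotate[OF d] b zero_closed[OF N0 Z] this]
  obtain c where c: "c \<in> hom_set C (ShO C 1 W) (ShO C 1 X)"
    and e: "ShA C 1 b \<cdot> neg C (ShA C 1 (Ident C W)) = neg C (ShA C 1 f) \<cdot> c"
    unfolding triangle_morphism_def by auto
  let ?a = "ShA C (- 1) c"
  have a: "?a \<in> hom_set C W X" using sh_down[OF W X c] .
  note b1 = sh_arr[OF b, of 1] and f1 = sh_arr[OF f, of 1]
  have i1: "Ident C (ShO C 1 W) \<in> hom_set C (ShO C 1 W) (ShO C 1 W)"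
    using ident_closed sh_obj[OF W] by blast
  have "neg C (ShA C 1 b) = neg C (ShA C 1 f \<cdot> c)"
    using e comp_neg_left[OF c f1] comp_neg_right[OF i1 b1] ident_right[OF b1] sh_ident[OF W]
    by simp
  then have "ShA C 1 b = ShA C 1 f \<cdot> c"
    using neg_neg[OF b1] neg_neg[OF comp_closed[OF c f1]] by metis
  also have "\<dots> = ShA C 1 (f \<cdot> ?a)"
    using sh_comp[OF a f] sh_arr_cancel(2)[OF c, of 1] by simp
  finally have "f \<cdot> ?a = b" using sh_inj[OF comp_closed[OF a f] b] by metis
  then show ?thesis using a by blast
qed

lemma hom_exact_right:
  assumes d: "dist_triangle C X Y Z f g h"
    and c: "c \<in> hom_set C W Z" and hc: "h \<cdot> c = Zero C W (ShO C 1 X)"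
  shows "\<exists>b \<in> hom_set C W Y. g \<cdot> b = c"
  using hom_exact_middle[OF rotate[OF d] c hc] .

text \<open>Stated with \<open>W[1]\<close> instead of \<open>Z[-1]\<close>, so that no arrow has to be desuspended.\<close>

lemma hom_exact_left:
  assumes d: "dist_triangle C X Y Z f g h"
    and a: "a \<in> hom_set C W X" and fa: "f \<cdot> a = Zero C W Y"
  shows "\<exists>c \<in> hom_set C (ShO C 1 W) Z. h \<cdot> c = ShA C 1 a"
proof -
  note f = dist_homs(1)[OF d]
  have "neg C (ShA C 1 f) \<cdot> ShA C 1 a = neg C (ShA C 1 (f \<cdot> a))"
    using comp_neg_left[OF sh_arr[OF a] sh_arr[OF f]] sh_comp[OF a f] by simp
  also have "\<dots> = Zero C (ShO C 1 W) (ShO C 1 Y)"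
    using fa sh_zero neg_zero hom_objs[OF a] hom_objs[OF f] sh_obj by simp
  finally show ?thesis using hom_exact_middle[OF rotate[OF rotate[OF d]] sh_arr[OF a]] by blast
qed

text \<open>Dually to \<open>hom_exact_middle\<close>, the given triangle is mapped to \<open>0 \<rightarrow> W \<rightarrow> W\<close>, which is
  distinguished because its rotation is the triangle of the identity of \<open>W\<close>.\<close>

lemma cohom_exact_middle:
  assumes d: "dist_triangle C X Y Z f g h"
    and b: "b \<in> hom_set C Y W" and bf: "b \<cdot> f = Zero C X W"
  shows "\<exists>c \<in> hom_set C Z W. c \<cdot> g = b"
proof -
  note X = dist_objs(1)[OF d] and W = hom_objs(2)[OF b]
  obtain N where N: "zero_object C N" using ex_zero_object by blast
  then have N0: "N \<in> Obj C" by (simp add: zero_object_def)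
  have N1: "ShO C 1 N \<in> Obj C" using sh_obj[OF N0] .
  have i: "Ident C N = Zero C N N"
    using zero_object_hom_to[OF N ident_closed[OF N0]] .
  have z1: "zero_object C (ShO C 1 N)"
    by (rule zero_object_if_ident_zero[OF N1])
      (use i sh_ident[OF N0, of 1] sh_zero[OF N0 N0, of 1] in simp)
  have "triangle C N W W (Zero C N W) (Ident C W) (Zero C W (ShO C 1 N))"
    unfolding triangle_def using zero_closed ident_closed N0 N1 W by blast
  then have w: "dist_triangle C N W W (Zero C N W) (Ident C W) (Zero C W (ShO C 1 N))"
    using TR2 TR1_ident[OF W z1] sh_zero[OF N0 W, of 1] neg_zero N1 sh_obj[OF W] by simp
  have "b \<cdot> f = Zero C N W \<cdot> Zero C X N"
    using bf comp_zero_left[OF zero_closed[OF X N0] W] by simp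
  from TR3[OF d w zero_closed[OF X N0] b this]
  obtain c where "c \<in> hom_set C Z W" "c \<cdot> g = Ident C W \<cdot> b"
    unfolding triangle_morphism_def by auto
  then show ?thesis using ident_left[OF b] by auto
qed

lemma cohom_exact_left:
  assumes d: "dist_triangle C X Y Z f g h"
    and a: "a \<in> hom_set C X W" and ah: "ShA C 1 a \<cdot> h = Zero C Z (ShO C 1 W)"
  shows "\<exists>b \<in> hom_set C Y W. b \<cdot> f = a"
proof -
  note f = dist_homs(1)[OF d] and W = hom_objs(2)[OF a] and Y = dist_objs(2)[OF d]
  obtain c where c: "c \<in> hom_set C (ShO C 1 Y) (ShO C 1 W)"
    and e: "c \<cdot> neg C (ShA C 1 f) = ShA C 1 a"
    using cohom_exact_middle[OF rotate[OF rotate[OF d]] sh_arr[OF a] ah] by blast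
  let ?b = "ShA C (- 1) (neg C c)"
  have b: "?b \<in> hom_set C Y W" using sh_down[OF Y W neg_closed[OF c]] .
  have "ShA C 1 (?b \<cdot> f) = neg C c \<cdot> ShA C 1 f"
    using sh_comp[OF f b] sh_arr_cancel(2)[OF neg_closed[OF c], of 1] by simp
  also have "\<dots> = ShA C 1 a"
    using e comp_neg_left[OF sh_arr[OF f] c] comp_neg_right[OF sh_arr[OF f] c] by simp
  finally have "?b \<cdot> f = a" using sh_inj[OF comp_closed[OF f b] a] by metis
  then show ?thesis using b by blast
qed

lemma orth_extension_left:
  assumes d: "dist_triangle C X Y Z f g h" and "orth X W" "orth Z W"
  shows "orth Y W"
  unfolding orth_def
proof
  fix u assume u: "u \<in> hom_set C Y W"
  have "u \<cdot> f = Zero C X W" using orthD[OF assms(2)] comp_closed[OF dist_homs(1)[OF d] u] .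
  then obtain c where "c \<in> hom_set C Z W" "c \<cdot> g = u" using cohom_exact_middle[OF d u] by blast
  then show "u = Zero C Y W"
    using orthD[OF assms(3)] comp_zero_left[OF dist_homs(2)[OF d] hom_objs(2)[OF u]] by blast
qed

lemma orth_extension_right:
  assumes d: "dist_triangle C X Y Z f g h" and "orth W X" "orth W Z"
  shows "orth W Y"
  unfolding orth_def
proof
  fix u assume u: "u \<in> hom_set C W Y"
  have "g \<cdot> u = Zero C W Z" using orthD[OF assms(3)] comp_closed[OF u dist_homs(2)[OF d]] .
  then obtain a where "a \<in> hom_set C W X" "f \<cdot> a = u" using hom_exact_middle[OF d u] by blast
  then show "u = Zero C W Y"
    using orthD[OF assms(2)] comp_zero_right[OF hom_objs(1)[OF u] dist_homs(1)[OF d]] by blast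
qed


section \<open>Aisles and co-aisles\<close>

lemma t_structure_objs:
  assumes "t_structure C D" shows "fst D \<subseteq> Obj C" "snd D \<subseteq> Obj C"
  using assms by (simp_all add: t_structure_def additive_subcat_def)

lemma additive_subcat_iso:
  "\<lbrakk>additive_subcat C S; X \<in> S; iso_arr C X Y f\<rbrakk> \<Longrightarrow> Y \<in> S"
  unfolding additive_subcat_def by blast

lemma le_iff:
  assumes "t_structure C D"
  shows "X \<in> le C D i \<longleftrightarrow> X \<in> Obj C \<and> ShO C i X \<in> fst D"
proof
  assume "X \<in> le C D i"
  then show "X \<in> Obj C \<and> ShO C i X \<in> fst D"
    using t_structure_objs(1)[OF assms] sh_obj unfolding le_def by (auto simp: subset_iff)
next
  assume "X \<in> Obj C \<and> ShO C i X \<in> fst D"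
  then show "X \<in> le C D i" unfolding le_def using sh_obj_cancel(1)[of X i] by (metis image_eqI)
qed

lemma ge_iff:
  assumes "t_structure C D"
  shows "X \<in> ge C D i \<longleftrightarrow> X \<in> Obj C \<and> ShO C i X \<in> snd D"
proof
  assume "X \<in> ge C D i"
  then show "X \<in> Obj C \<and> ShO C i X \<in> snd D"
    using t_structure_objs(2)[OF assms] sh_obj unfolding ge_def by (auto simp: subset_iff)
next
  assume "X \<in> Obj C \<and> ShO C i X \<in> snd D"
  then show "X \<in> ge C D i" unfolding ge_def using sh_obj_cancel(1)[of X i] by (metis image_eqI)
qed

lemma le_obj: "\<lbrakk>t_structure C D; X \<in> le C D i\<rbrakk> \<Longrightarrow> X \<in> Obj C"
  by (simp add: le_iff)

lemma ge_obj: "\<lbrakk>t_structure C D; X \<in> ge C D i\<rbrakk> \<Longrightarrow> X \<in> Obj C"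
  by (simp add: ge_iff)

lemma le_shift_iff:
  assumes "t_structure C D" "X \<in> Obj C"
  shows "ShO C j X \<in> le C D i \<longleftrightarrow> X \<in> le C D (i + j)"
  using assms by (simp add: le_iff sh_obj sh_obj_sum)

lemma ge_shift_iff:
  assumes "t_structure C D" "X \<in> Obj C"
  shows "ShO C j X \<in> ge C D i \<longleftrightarrow> X \<in> ge C D (i + j)"
  using assms by (simp add: ge_iff sh_obj sh_obj_sum)

lemma le_iso:
  assumes D: "t_structure C D" and "X \<in> le C D i" and f: "iso_arr C X Y f"
  shows "Y \<in> le C D i"
proof -
  have "Y \<in> Obj C" using f hom_objs unfolding iso_arr_def by blast
  moreover have "ShO C i Y \<in> fst D"
    using additive_subcat_iso[of "fst D"] D assms(2) iso_sh[OF f, of i] le_iff[OF D]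
    unfolding t_structure_def by blast
  ultimately show ?thesis using le_iff[OF D] by blast
qed

lemma ge_iso:
  assumes D: "t_structure C D" and "X \<in> ge C D i" and f: "iso_arr C X Y f"
  shows "Y \<in> ge C D i"
proof -
  have "Y \<in> Obj C" using f hom_objs unfolding iso_arr_def by blast
  moreover have "ShO C i Y \<in> snd D"
    using additive_subcat_iso[of "snd D"] D assms(2) iso_sh[OF f, of i] ge_iff[OF D]
    unfolding t_structure_def by blast
  ultimately show ?thesis using ge_iff[OF D] by blast
qed

lemma le_mono:
  assumes D: "t_structure C D" and "i \<le> j"
  shows "le C D i \<subseteq> le C D j"
  using \<open>i \<le> j\<close>
proof (induction j rule: int_ge_induct)
  case (step j)
  have "le C D j \<subseteq> le C D (j + 1)"
  proof
    fix X assume X: "X \<in> le C D j"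
    note o = le_obj[OF D X]
    have "ShO C j X \<in> le C D 0" using X le_shift_iff[OF D o] by simp
    then have "ShO C j X \<in> le C D 1" using D by (auto simp: t_structure_def)
    then show "X \<in> le C D (j + 1)" using le_shift_iff[OF D o] by (simp add: add.commute)
  qed
  then show ?case using step by blast
qed simp

lemma ge_antimono:
  assumes D: "t_structure C D" and "i \<le> j"
  shows "ge C D j \<subseteq> ge C D i"
  using \<open>i \<le> j\<close>
proof (induction j rule: int_ge_induct)
  case (step j)
  have "ge C D (j + 1) \<subseteq> ge C D j"
  proof
    fix X assume X: "X \<in> ge C D (j + 1)"
    note o = ge_obj[OF D X]
    have "ShO C j X \<in> ge C D 1" using X ge_shift_iff[OF D o] by (simp add: add.commute)
    then have "ShO C j X \<in> ge C D 0" using D by (auto simp: t_structure_def)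
    then show "X \<in> ge C D j" using ge_shift_iff[OF D o] by simp
  qed
  then show ?case using step by blast
qed simp

lemma orth_le_ge:
  assumes D: "t_structure C D" and X: "X \<in> le C D i" and Y: "Y \<in> ge C D j" and ij: "i < j"
  shows "orth X Y"
proof -
  have Y': "Y \<in> ge C D (1 + i)" using Y ge_antimono[OF D, of "1 + i" j] ij by auto
  note oX = le_obj[OF D X] and oY = ge_obj[OF D Y]
  have "ShO C i X \<in> le C D 0" "ShO C i Y \<in> ge C D 1"
    using le_shift_iff[OF D oX] ge_shift_iff[OF D oY] X Y' by auto
  then have "orth (ShO C i X) (ShO C i Y)"
    using D unfolding t_structure_def orth_def by blast
  then show ?thesis using orth_sh[OF oX oY] by blast
qed

lemma truncation_triangle:
  assumes D: "t_structure C D" and X: "X \<in> Obj C"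
  shows "\<exists>A \<in> le C D i. \<exists>B \<in> ge C D (i + 1). \<exists>f g h. dist_triangle C A X B f g h"
proof -
  obtain A B f g h where A: "A \<in> le C D 0" and B: "B \<in> ge C D 1"
    and d: "dist_triangle C A (ShO C i X) B f g h"
    using D sh_obj[OF X] unfolding t_structure_def by blast
  obtain f g h where "dist_triangle C (ShO C (- i) A) X (ShO C (- i) B) f g h"
    using dist_shift[OF d, of "- i"] X by auto
  moreover have "ShO C (- i) A \<in> le C D i" "ShO C (- i) B \<in> ge C D (i + 1)"
    using le_shift_iff[OF D le_obj[OF D A]] ge_shift_iff[OF D ge_obj[OF D B]] A B by auto
  ultimately show ?thesis by blast
qed

text \<open>The arrow \<open>X \<rightarrow> B\<close> of the truncation triangle vanishes.  Then the identity of \<open>B\<close> factors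
  through \<open>A[1]\<close>, which is orthogonal to \<open>B\<close>; so \<open>B\<close> is zero and \<open>A \<rightarrow> X\<close> is invertible.\<close>

lemma le_if_orth:
  assumes D: "t_structure C D" and X: "X \<in> Obj C"
    and o: "\<And>Y. Y \<in> ge C D (i + 1) \<Longrightarrow> orth X Y"
  shows "X \<in> le C D i"
proof -
  obtain A B f g h where A: "A \<in> le C D i" and B: "B \<in> ge C D (i + 1)"
    and d: "dist_triangle C A X B f g h"
    using truncation_triangle[OF D X] by blast
  note f = dist_homs(1)[OF d] and g = dist_homs(2)[OF d] and h = dist_homs(3)[OF d]
  note oA = dist_objs(1)[OF d] and oB = dist_objs(3)[OF d]
  have g0: "g = Zero C X B" using orthD[OF o[OF B] g] .
  obtain e where e: "e \<in> hom_set C (ShO C 1 A) B" and eh: "e \<cdot> h = Ident C B"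
    using cohom_exact_middle[OF rotate[OF d] ident_closed[OF oB]] ident_left[OF g] g0 by auto
  have "ShO C 1 A \<in> le C D (i - 1)" using le_shift_iff[OF D oA] A by simp
  then have "e = Zero C (ShO C 1 A) B" using orthD[OF orth_le_ge[OF D _ B]] e by simp
  then have B0: "Ident C B = Zero C B B" using eh comp_zero_left[OF h oB] by simp
  have h0: "h = Zero C B (ShO C 1 A)" using ident_right[OF h] comp_zero_right[OF oB h] B0 by simp
  obtain s where s: "s \<in> hom_set C X A" "f \<cdot> s = Ident C X"
    using hom_exact_middle[OF d ident_closed[OF X]] ident_right[OF g] g0 by auto
  have "ShA C 1 (Ident C A) \<cdot> h = Zero C B (ShO C 1 A)"
    using sh_ident[OF oA] ident_left[OF h] h0 by simp
  then obtain r where "r \<in> hom_set C X A" "r \<cdot> f = Ident C A"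
    using cohom_exact_left[OF d ident_closed[OF oA]] by blast
  then have "iso_arr C A X f" using iso_if_split_both[OF f] s by blast
  then show ?thesis using le_iso[OF D A] by blast
qed

text \<open>Dual to \<open>le_if_orth\<close>: here \<open>A \<rightarrow> X\<close> vanishes, so the identity of \<open>A[1]\<close> factors through \<open>B\<close>
  and \<open>X \<rightarrow> B\<close> is invertible.\<close>

lemma ge_if_orth:
  assumes D: "t_structure C D" and X: "X \<in> Obj C"
    and o: "\<And>A. A \<in> le C D i \<Longrightarrow> orth A X"
  shows "X \<in> ge C D (i + 1)"
proof -
  obtain A B f g h where A: "A \<in> le C D i" and B: "B \<in> ge C D (i + 1)"
    and d: "dist_triangle C A X B f g h"
    using truncation_triangle[OF D X] by blast
  note f = dist_homs(1)[OF d] and g = dist_homs(2)[OF d] and h = dist_homs(3)[OF d]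
  note oA = dist_objs(1)[OF d] and oB = dist_objs(3)[OF d]
  have f0: "f = Zero C A X" using orthD[OF o[OF A] f] .
  obtain e where e: "e \<in> hom_set C (ShO C 1 A) B" and he: "h \<cdot> e = Ident C (ShO C 1 A)"
    using hom_exact_left[OF d ident_closed[OF oA]] ident_right[OF f] f0 sh_ident[OF oA] by auto
  have "ShO C 1 A \<in> le C D (i - 1)" using le_shift_iff[OF D oA] A by simp
  then have "e = Zero C (ShO C 1 A) B" using orthD[OF orth_le_ge[OF D _ B]] e by simp
  then have A0: "Ident C (ShO C 1 A) = Zero C (ShO C 1 A) (ShO C 1 A)"
    using he comp_zero_right[OF sh_obj[OF oA] h] by simp
  have h0: "h = Zero C B (ShO C 1 A)"
    using ident_left[OF h] comp_zero_left[OF h sh_obj[OF oA]] A0 by simp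
  obtain r where r: "r \<in> hom_set C B X" "r \<cdot> g = Ident C X"
    using cohom_exact_middle[OF d ident_closed[OF X]] ident_left[OF f] f0 by auto
  obtain s where "s \<in> hom_set C B X" "g \<cdot> s = Ident C B"
    using hom_exact_right[OF d ident_closed[OF oB]] ident_right[OF h] h0 by auto
  then have "iso_arr C X B g" using iso_if_split_both[OF g] r by blast
  then show ?thesis using ge_iso[OF D B] iso_arr_sym by blast
qed

lemma le_extension:
  assumes D: "t_structure C D" and d: "dist_triangle C X Y Z f g h"
    and "X \<in> le C D i" "Z \<in> le C D i"
  shows "Y \<in> le C D i"
proof (rule le_if_orth[OF D dist_objs(2)[OF d]])
  fix W assume "W \<in> ge C D (i + 1)"
  then show "orth Y W" using orth_extension_left[OF d] orth_le_ge[OF D] assms(3,4) by simp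
qed

lemma ge_extension:
  assumes D: "t_structure C D" and d: "dist_triangle C X Y Z f g h"
    and "X \<in> ge C D i" "Z \<in> ge C D i"
  shows "Y \<in> ge C D i"
proof -
  have "Y \<in> ge C D ((i - 1) + 1)"
  proof (rule ge_if_orth[OF D dist_objs(2)[OF d]])
    fix W assume "W \<in> le C D (i - 1)"
    then show "orth W Y" using orth_extension_right[OF d] orth_le_ge[OF D] assms(3,4) by simp
  qed
  then show ?thesis by simp
qed

lemma le_cone:
  assumes D: "t_structure C D" and d: "dist_triangle C X Y Z f g h"
    and X: "X \<in> le C D (i + 1)" and Y: "Y \<in> le C D i"
  shows "Z \<in> le C D i"
  using le_extension[OF D rotate[OF d] Y] le_shift_iff[OF D le_obj[OF D X]] X by simp

lemma ge_cone:
  assumes D: "t_structure C D" and d: "dist_triangle C X Y Z f g h"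
    and X: "X \<in> ge C D (i + 1)" and Y: "Y \<in> ge C D i"
  shows "Z \<in> ge C D i"
  using ge_extension[OF D rotate[OF d] Y] ge_shift_iff[OF D ge_obj[OF D X]] X by simp

lemma ge_cocone:
  assumes D: "t_structure C D" and d: "dist_triangle C X Y Z f g h"
    and Y: "Y \<in> ge C D i" and Z: "Z \<in> ge C D (i - 1)"
  shows "X \<in> ge C D i"
proof -
  obtain k where "dist_triangle C (ShO C (- 1) Z) X Y k f g" using rotate_back[OF d] by blast
  then show ?thesis using ge_extension[OF D] Y ge_shift_iff[OF D ge_obj[OF D Z]] Z by simp
qed


section \<open>Truncation functors\<close>

text \<open>The part of a right adjoint to the inclusion of \<open>S\<close> that concerns a single object \<open>X\<close>: its
  value \<open>A\<close> and the counit \<open>e\<close>.\<close>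

definition coreflection :: "'o set \<Rightarrow> 'o \<Rightarrow> 'o \<Rightarrow> 'm \<Rightarrow> bool" where
  "coreflection S X A e \<longleftrightarrow> A \<in> S \<and> e \<in> hom_set C A X \<and>
     (\<forall>B \<in> S. bij_betw (\<lambda>g. e \<cdot> g) (hom_set C B A) (hom_set C B X))"

text \<open>For \<open>U\<close> in the aisle, \<open>Hom(U, B) = 0\<close> gives surjectivity and \<open>Hom(U[1], B) = 0\<close> gives
  injectivity, by the long exact sequence.\<close>

lemma coreflection_truncation_triangle:
  assumes D: "t_structure C D" and d: "dist_triangle C A X B e p q"
    and A: "A \<in> le C D i" and B: "B \<in> ge C D (i + 1)"
  shows "coreflection (le C D i) X A e"
  unfolding coreflection_def
proof (intro conjI ballI)
  note e = dist_homs(1)[OF d] and p = dist_homs(2)[OF d] and q = dist_homs(3)[OF d]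
  show "A \<in> le C D i" by fact
  show "e \<in> hom_set C A X" by fact
  fix U assume U: "U \<in> le C D i"
  note oU = le_obj[OF D U]
  have U1: "ShO C 1 U \<in> le C D (i - 1)" using le_shift_iff[OF D oU] U by simp
  have inj: "g = g'" if g: "g \<in> hom_set C U A" and g': "g' \<in> hom_set C U A"
    and eq: "e \<cdot> g = e \<cdot> g'" for g g'
  proof -
    let ?a = "g \<boxplus> neg C g'"
    interpret G: comm_group "hom_group C U A" using hom_comm_group[OF hom_objs[OF g]] .
    have a: "?a \<in> hom_set C U A"
      using G.m_closed[of g "neg C g'"] g neg_closed[OF g'] by (simp add: hom_group_def)
    have "e \<cdot> ?a = Zero C U X"
      using comp_add_right[OF g neg_closed[OF g'] e] comp_neg_right[OF g' e] eq
        add_neg[OF comp_closed[OF g' e]] by simp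
    then obtain c where c: "c \<in> hom_set C (ShO C 1 U) B" and qc: "q \<cdot> c = ShA C 1 ?a"
      using hom_exact_left[OF d a] by blast
    have "c = Zero C (ShO C 1 U) B" using orthD[OF orth_le_ge[OF D U1 B] c] by simp
    then have "ShA C 1 ?a = Zero C (ShO C 1 U) (ShO C 1 A)"
      using qc comp_zero_right[OF sh_obj[OF oU] q] by simp
    then have "?a = Zero C U A" using zero_if_sh_zero[OF a] by blast
    then show ?thesis using eq_if_diff_zero[OF g g'] by blast
  qed
  have surj: "\<exists>g \<in> hom_set C U A. e \<cdot> g = u" if u: "u \<in> hom_set C U X" for u
  proof -
    have "orth U B" using orth_le_ge[OF D U B] by simp
    then have "p \<cdot> u = Zero C U B" using orthD comp_closed[OF u p] by blast
    then show ?thesis using hom_exact_middle[OF d u] by blast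
  qed
  show "bij_betw (\<lambda>g. e \<cdot> g) (hom_set C U A) (hom_set C U X)"
    unfolding bij_betw_def inj_on_def using inj surj comp_closed[OF _ e] by blast
qed

text \<open>Compatibility speaks of all truncation functors, so a conclusion can only be drawn
  from it once one is built.  The universal properties determine the functor from its values
  on objects, and these can be chosen freely among the coreflections; prescribing the value at one
  object \<open>Z\<close> makes it possible to apply compatibility to a given triangle.\<close>

lemma ex_right_adjoint_incl:
  assumes S: "S \<subseteq> Obj C" and ex: "\<And>X. X \<in> Obj C \<Longrightarrow> \<exists>A e. coreflection S X A e"
    and Z: "coreflection S Z A e"
  shows "\<exists>Fo Fm \<epsilon>. right_adjoint_incl C S Fo Fm \<epsilon> \<and> Fo Z = A"
proof -
  have "\<forall>X. \<exists>B u. X \<in> Obj C \<longrightarrow> coreflection S X B u" using ex by blast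
  then obtain Fo0 \<epsilon>0 where c0: "\<And>X. X \<in> Obj C \<Longrightarrow> coreflection S X (Fo0 X) (\<epsilon>0 X)" by metis
  define Fo where "Fo = Fo0(Z := A)"
  define \<epsilon> where "\<epsilon> = \<epsilon>0(Z := e)"
  have c: "coreflection S X (Fo X) (\<epsilon> X)" if "X \<in> Obj C" for X
    using c0[OF that] Z by (simp add: Fo_def \<epsilon>_def)
  have FoS: "Fo X \<in> S" and \<epsilon>h: "\<epsilon> X \<in> hom_set C (Fo X) X" if "X \<in> Obj C" for X
    using c[OF that] by (simp_all add: coreflection_def)
  have bij: "bij_betw (\<lambda>g. \<epsilon> X \<cdot> g) (hom_set C B (Fo X)) (hom_set C B X)"
    if "X \<in> Obj C" "B \<in> S" for X B
    using c[OF that(1)] that(2) by (simp add: coreflection_def)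
  define Fm where "Fm f = (THE g. g \<in> hom_set C (Fo (Dom C f)) (Fo (Cod C f)) \<and>
      \<epsilon> (Cod C f) \<cdot> g = f \<cdot> \<epsilon> (Dom C f))" for f
  have inj: "g = g'" if "X \<in> Obj C" "B \<in> S" "g \<in> hom_set C B (Fo X)" "g' \<in> hom_set C B (Fo X)"
    "\<epsilon> X \<cdot> g = \<epsilon> X \<cdot> g'" for X B g g'
    using bij[OF that(1,2)] that(3-5) unfolding bij_betw_def inj_on_def by blast
  have Fm: "Fm f \<in> hom_set C (Fo X) (Fo Y) \<and> \<epsilon> Y \<cdot> Fm f = f \<cdot> \<epsilon> X"
    if f: "f \<in> hom_set C X Y" for f X Y
  proof -
    note X = hom_objs(1)[OF f] and Y = hom_objs(2)[OF f]
    have DC: "Dom C f = X" "Cod C f = Y" using f by (auto simp: hom_set_def)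
    have "f \<cdot> \<epsilon> X \<in> hom_set C (Fo X) Y" using comp_closed[OF \<epsilon>h[OF X] f] .
    then obtain g where g: "g \<in> hom_set C (Fo X) (Fo Y)" "\<epsilon> Y \<cdot> g = f \<cdot> \<epsilon> X"
      using bij[OF Y FoS[OF X]] unfolding bij_betw_def by (metis imageE)
    have "\<exists>!g. g \<in> hom_set C (Fo X) (Fo Y) \<and> \<epsilon> Y \<cdot> g = f \<cdot> \<epsilon> X"
    proof (rule ex1I[of _ g])
      fix g' assume "g' \<in> hom_set C (Fo X) (Fo Y) \<and> \<epsilon> Y \<cdot> g' = f \<cdot> \<epsilon> X"
      then show "g' = g" using inj[OF Y FoS[OF X], of g' g] g by simp
    qed (use g in simp)
    from theI'[OF this] show ?thesis by (simp add: Fm_def DC)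
  qed
  have Fm_ident: "Fm (Ident C X) = Ident C (Fo X)" if X: "X \<in> Obj C" for X
  proof -
    have oF: "Fo X \<in> Obj C" using FoS[OF X] S by blast
    show ?thesis
      using inj[OF X FoS[OF X], of "Fm (Ident C X)" "Ident C (Fo X)"] Fm[OF ident_closed[OF X]]
        ident_closed[OF oF] ident_left[OF \<epsilon>h[OF X]] ident_right[OF \<epsilon>h[OF X]] by simp
  qed
  have Fm_comp: "Fm (g \<cdot> f) = Fm g \<cdot> Fm f"
    if f: "f \<in> hom_set C X Y" and g: "g \<in> hom_set C Y W" for f g X Y W
  proof -
    note X = hom_objs(1)[OF f] and Y = hom_objs(2)[OF f] and W = hom_objs(2)[OF g]
    have Ff: "Fm f \<in> hom_set C (Fo X) (Fo Y)" "\<epsilon> Y \<cdot> Fm f = f \<cdot> \<epsilon> X" using Fm[OF f] by auto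
    have Fg: "Fm g \<in> hom_set C (Fo Y) (Fo W)" "\<epsilon> W \<cdot> Fm g = g \<cdot> \<epsilon> Y" using Fm[OF g] by auto
    have "\<epsilon> W \<cdot> (Fm g \<cdot> Fm f) = (g \<cdot> \<epsilon> Y) \<cdot> Fm f"
      using comp_assoc[OF Ff(1) Fg(1) \<epsilon>h[OF W]] Fg(2) by simp
    also have "\<dots> = (g \<cdot> f) \<cdot> \<epsilon> X"
      using comp_assoc[OF Ff(1) \<epsilon>h[OF Y] g] comp_assoc[OF \<epsilon>h[OF X] f g] Ff(2) by simp
    finally show ?thesis
      using inj[OF W FoS[OF X], of "Fm (g \<cdot> f)" "Fm g \<cdot> Fm f"] Fm[OF comp_closed[OF f g]]
        comp_closed[OF Ff(1) Fg(1)] by simp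
  qed
  have "right_adjoint_incl C S Fo Fm \<epsilon>"
    unfolding right_adjoint_incl_def using FoS \<epsilon>h bij Fm Fm_ident Fm_comp by auto
  moreover have "Fo Z = A" by (simp add: Fo_def)
  ultimately show ?thesis by blast
qed

lemma left_compatible_truncation_triangle:
  assumes D: "t_structure C D" and lc: "left_compatible C D T"
    and d: "dist_triangle C A Z B e p q" and A: "A \<in> le C D i" and B: "B \<in> ge C D (i + 1)"
    and Z: "Z \<in> le C T 0"
  shows "A \<in> le C T 0"
proof -
  have "\<exists>A e. coreflection (le C D i) X A e" if "X \<in> Obj C" for X
    using truncation_triangle[OF D that] coreflection_truncation_triangle[OF D] by blast
  moreover have "le C D i \<subseteq> Obj C" using le_obj[OF D] by blast
  ultimately obtain Fo Fm \<epsilon> where "truncation C D i Fo Fm \<epsilon>" "Fo Z = A"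
    using ex_right_adjoint_incl coreflection_truncation_triangle[OF D d A B]
    unfolding truncation_def by metis
  then show ?thesis using lc Z unfolding left_compatible_def by blast
qed

text \<open>A section \<open>s\<close> of the counit comes from surjectivity at the identity of \<open>X\<close>; injectivity shows
  that \<open>s\<close> is also a retraction, since both \<open>s \<cdot> \<epsilon> X\<close> and the identity have composite \<open>\<epsilon> X\<close>.\<close>

lemma counit_iso:
  assumes F: "right_adjoint_incl C S Fo Fm \<epsilon>" and X: "X \<in> S" "X \<in> Obj C"
  shows "iso_arr C (Fo X) X (\<epsilon> X)"
proof -
  have \<epsilon>: "\<epsilon> X \<in> hom_set C (Fo X) X" and FX: "Fo X \<in> S"
    using F X(2) by (auto simp: right_adjoint_incl_def)
  have bij: "bij_betw (\<lambda>g. \<epsilon> X \<cdot> g) (hom_set C B (Fo X)) (hom_set C B X)" if "B \<in> S" for B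
    using F X(2) that by (auto simp: right_adjoint_incl_def)
  obtain s where s: "s \<in> hom_set C X (Fo X)" "\<epsilon> X \<cdot> s = Ident C X"
    using bij[OF X(1)] ident_closed[OF X(2)] unfolding bij_betw_def by (metis imageE)
  have "\<epsilon> X \<cdot> (s \<cdot> \<epsilon> X) = \<epsilon> X \<cdot> Ident C (Fo X)"
    using comp_assoc[OF \<epsilon> s(1) \<epsilon>] s(2) ident_left[OF \<epsilon>] ident_right[OF \<epsilon>] by simp
  moreover have "s \<cdot> \<epsilon> X \<in> hom_set C (Fo X) (Fo X)" using comp_closed[OF \<epsilon> s(1)] .
  moreover have "Ident C (Fo X) \<in> hom_set C (Fo X) (Fo X)"
    using ident_closed hom_objs(1)[OF \<epsilon>] by blast
  ultimately have "s \<cdot> \<epsilon> X = Ident C (Fo X)"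
    using bij[OF FX] unfolding bij_betw_def inj_on_def by blast
  then show ?thesis unfolding iso_arr_def using \<epsilon> s by blast
qed


section \<open>Monomorphisms of the heart\<close>

text \<open>A priori the cone \<open>W\<close> lies in \<open>D\<^sup>\<le>\<^sup>0 \<inter> D\<^sup>\<ge>\<^sup>-\<^sup>1\<close>, and the obstruction to being in the heart is
  its truncation \<open>A = K[1]\<close>, where \<open>K\<close> is the kernel of \<open>f\<close>.  The map \<open>K \<rightarrow> X\<close> induced by
  \<open>A \<rightarrow> W \<rightarrow> X[1]\<close> is killed by \<open>f\<close>, hence zero, and this makes the truncation map \<open>A \<rightarrow> W\<close> zero.\<close>

lemma cone_of_heart_mono:
  assumes D: "t_structure C D" and m: "mono_in C (heart C D) X Y f"
    and d: "dist_triangle C X Y W f g h"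
  shows "W \<in> heart C D"
proof -
  note f = dist_homs(1)[OF d] and g = dist_homs(2)[OF d] and h = dist_homs(3)[OF d]
  note oX = dist_objs(1)[OF d] and oY = dist_objs(2)[OF d] and oW = dist_objs(3)[OF d]
  have X: "X \<in> le C D 0" "X \<in> ge C D 0" and Y: "Y \<in> le C D 0" "Y \<in> ge C D 0"
    using m by (auto simp: mono_in_def heart_def)
  have Wle: "W \<in> le C D 0"
    using le_cone[OF D d _ Y(1)] le_mono[OF D, of 0 1] X(1) by auto
  have Wge: "W \<in> ge C D (- 1)"
    using ge_cone[OF D d, of "- 1"] ge_antimono[OF D, of "- 1" 0] X(2) Y(2) by auto
  obtain A B e p q where A: "A \<in> le C D (- 1)" and B: "B \<in> ge C D 0"
    and t: "dist_triangle C A W B e p q"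
    using truncation_triangle[OF D oW, of "- 1"] by auto
  note e = dist_homs(1)[OF t] and p = dist_homs(2)[OF t] and oA = dist_objs(1)[OF t]
  have "B \<in> ge C D (- 2)" using ge_antimono[OF D, of "- 2" 0] B by auto
  then have A': "A \<in> ge C D (- 1)" using ge_cocone[OF D t Wge] by simp
  let ?K = "ShO C (- 1) A"
  have K: "?K \<in> heart C D"
    unfolding heart_def using le_shift_iff[OF D oA] ge_shift_iff[OF D oA] A A' by simp
  have oK: "?K \<in> Obj C" using sh_obj[OF oA] .
  have K1: "ShO C 1 ?K = A" using oA by simp
  note he = comp_closed[OF e h]
  define k where "k = ShA C (- 1) (h \<cdot> e)"
  have k: "k \<in> hom_set C ?K X" unfolding k_def using sh_down[OF oK oX] he K1 by metis
  have k1: "ShA C 1 k = h \<cdot> e" unfolding k_def using sh_arr_cancel(2)[OF he, of 1] by simp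
  \<comment> \<open>Two consecutive arrows of the twice rotated triangle compose to zero, so \<open>f\<close> kills \<open>k\<close>.\<close>
  note f1 = sh_arr[OF f, of 1]
  have "neg C (ShA C 1 f \<cdot> h) = Zero C W (ShO C 1 Y)"
    using dist_comp_zero[OF rotate[OF rotate[OF d]]] comp_neg_left[OF h f1] by simp
  then have fh: "ShA C 1 f \<cdot> h = Zero C W (ShO C 1 Y)"
    using neg_neg[OF comp_closed[OF h f1]] neg_zero[OF oW sh_obj[OF oY]] by metis
  have "ShA C 1 (f \<cdot> k) = (ShA C 1 f \<cdot> h) \<cdot> e"
    using sh_comp[OF k f] k1 comp_assoc[OF e h f1] by simp
  also have "\<dots> = Zero C (ShO C 1 ?K) (ShO C 1 Y)"
    using fh comp_zero_left[OF e sh_obj[OF oY]] K1 by simp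
  finally have "f \<cdot> k = Zero C ?K Y" using zero_if_sh_zero[OF comp_closed[OF k f]] by blast
  then have "f \<cdot> k = f \<cdot> Zero C ?K X" using comp_zero_right[OF oK f] by simp
  then have "k = Zero C ?K X"
    using m K k zero_closed[OF oK oX] unfolding mono_in_def by blast
  \<comment> \<open>Now \<open>A \<rightarrow> W\<close> factors through \<open>Y\<close>, which lies in \<open>D\<^sup>\<ge>\<^sup>0\<close>, while \<open>A\<close> lies in \<open>D\<^sup>\<le>\<^sup>-\<^sup>1\<close>.\<close>
  then have "h \<cdot> e = Zero C A (ShO C 1 X)" using k1 sh_zero[OF oK oX, of 1] K1 by simp
  then obtain b where b: "b \<in> hom_set C A Y" and gb: "g \<cdot> b = e"
    using hom_exact_right[OF d e] by blast
  have "b = Zero C A Y" using orthD[OF orth_le_ge[OF D A Y(2)] b] by simp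
  then have e0: "e = Zero C A W" using gb comp_zero_right[OF oA g] by simp
  have "W \<in> ge C D (- 1 + 1)"
  proof (rule ge_if_orth[OF D oW])
    fix U assume U: "U \<in> le C D (- 1)"
    show "orth U W" unfolding orth_def
    proof
      fix u assume u: "u \<in> hom_set C U W"
      have "orth U B" using orth_le_ge[OF D U B] by simp
      then have "p \<cdot> u = Zero C U B" using orthD comp_closed[OF u p] by blast
      then obtain v where "v \<in> hom_set C U A" "e \<cdot> v = u" using hom_exact_middle[OF t u] by blast
      then show "u = Zero C U W" using e0 comp_zero_left oW by metis
    qed
  qed
  then show ?thesis using Wle by (simp add: heart_def)
qed

text \<open>The octahedral axiom is applied to \<open>Y\<^sub>0 \<rightarrow> Q \<rightarrow> Y\<^sub>1\<close>, where \<open>Q\<close> is the cokernel of \<open>X\<close> in \<open>Y\<^sub>0\<close>: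
  the cones of the two factors are \<open>X[1]\<close> and the cokernel \<open>E\<close> of \<open>Q\<close> in \<open>Y\<^sub>1\<close>, and the cone of the
  composite is \<open>Z\<close>.\<close>

lemma shifted_heart_truncates_cone:
  assumes D: "t_structure C D" and T: "t_structure C T"
    and cog: "cogenerates C (heart C D \<inter> heart C T) (heart C D)" and X: "X \<in> heart C D"
  shows "\<exists>Z \<in> le C T 0. \<exists>E \<in> ge C D 0. \<exists>u v w. dist_triangle C (ShO C 1 X) Z E u v w"
proof -
  obtain Y\<^sub>0 f where Y0: "Y\<^sub>0 \<in> heart C T" and f: "mono_in C (heart C D) X Y\<^sub>0 f"
    using cog X unfolding cogenerates_def by blast
  obtain Q g h where d: "dist_triangle C X Y\<^sub>0 Q f g h"
    using f TR1_cone unfolding mono_in_def by blast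
  have "Q \<in> heart C D" using cone_of_heart_mono[OF D f d] .
  then obtain Y\<^sub>1 j where Y1: "Y\<^sub>1 \<in> heart C T" and j: "mono_in C (heart C D) Q Y\<^sub>1 j"
    using cog unfolding cogenerates_def by blast
  have jh: "j \<in> hom_set C Q Y\<^sub>1" using j by (simp add: mono_in_def)
  obtain E p\<^sub>3 d\<^sub>3 where d3: "dist_triangle C Q Y\<^sub>1 E j p\<^sub>3 d\<^sub>3" using TR1_cone[OF jh] by blast
  have E: "E \<in> ge C D 0" using cone_of_heart_mono[OF D j d3] by (simp add: heart_def)
  note g = dist_homs(2)[OF d]
  obtain Z p\<^sub>2 d\<^sub>2 where d2: "dist_triangle C Y\<^sub>0 Y\<^sub>1 Z (j \<cdot> g) p\<^sub>2 d\<^sub>2"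
    using TR1_cone[OF comp_closed[OF g jh]] by blast
  have "Z \<in> le C T 0"
    using le_cone[OF T d2, of 0] Y0 Y1 le_mono[OF T, of 0 1] by (auto simp: heart_def)
  then show ?thesis using TR4[OF g jh rotate[OF d] d2 d3] E by blast
qed


section \<open>Compatibility and the type\<close>

text \<open>Devissage: an object of \<open>D\<^sup>\<le>\<^sup>i\<close> is an extension of a shift \<open>H[-i]\<close> of an object of the heart by an
  object of \<open>D\<^sup>\<le>\<^sup>i\<^sup>-\<^sup>1\<close>, so the inclusion climbs from \<open>i = -n\<close> to \<open>i = -1\<close> one step at a time.\<close>

lemma le_subset_from_heart:
  assumes D: "t_structure C D" and T: "t_structure C T"
    and H: "\<And>X. X \<in> heart C D \<Longrightarrow> ShO C 1 X \<in> le C T 0"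
    and n: "le C D (- int n) \<subseteq> le C T 0"
  shows "le C D (- 1) \<subseteq> le C T 0"
proof -
  have step: "le C D i \<subseteq> le C T 0" if i: "i \<le> - 1" and IH: "le C D (i - 1) \<subseteq> le C T 0" for i
  proof
    fix X assume X: "X \<in> le C D i"
    obtain A B f g h where A: "A \<in> le C D (i - 1)" and B: "B \<in> ge C D i"
      and d: "dist_triangle C A X B f g h"
      using truncation_triangle[OF D le_obj[OF D X], of "i - 1"] by auto
    have "A \<in> le C D (i + 1)" using A le_mono[OF D, of "i - 1" "i + 1"] by auto
    then have B': "B \<in> le C D i" using le_cone[OF D d _ X] by blast
    note oB = dist_objs(3)[OF d]
    have "ShO C i B \<in> heart C D"
      unfolding heart_def using B B' le_shift_iff[OF D oB] ge_shift_iff[OF D oB] by simp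
    from H[OF this] have "B \<in> le C T (1 + i)"
      using le_shift_iff[OF T oB, of "1 + i" 0] oB by (simp add: sh_obj_sum)
    then have "B \<in> le C T 0" using le_mono[OF T, of "1 + i" 0] i by auto
    then show "X \<in> le C T 0" using le_extension[OF T d] A IH by blast
  qed
  have "le C D (- 1 - int m) \<subseteq> le C T 0 \<Longrightarrow> le C D (- 1) \<subseteq> le C T 0" for m
  proof (induction m)
    case (Suc m)
    have "- 1 - int m - 1 = - 1 - int (Suc m)" by simp
    then show ?case using Suc step[of "- 1 - int m"] by simp
  qed simp
  \<comment> \<open>For \<open>n = 0\<close> the hypothesis starts above \<open>-1\<close>; starting the climb at \<open>-1 - n\<close> covers this case too.\<close>
  moreover have "le C D (- 1 - int n) \<subseteq> le C T 0"
    using n le_mono[OF D, of "- 1 - int n" "- int n"] by auto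
  ultimately show ?thesis by blast
qed

lemma left_compatible_if_near:
  assumes D: "t_structure C D" and T: "t_structure C T"
    and TD: "le C T 0 \<subseteq> le C D 0" and DT: "le C D (- 1) \<subseteq> le C T 0"
  shows "left_compatible C D T"
  unfolding left_compatible_def
proof (intro allI impI subsetI)
  fix i Fo Fm \<epsilon> Y
  assume tr: "truncation C D i Fo Fm \<epsilon>" and "Y \<in> Fo ` le C T 0"
  then obtain X where X: "X \<in> le C T 0" and Y: "Y = Fo X" by blast
  note oX = le_obj[OF T X]
  show "Y \<in> le C T 0"
  proof (cases "i \<le> - 1")
    case True
    have "Fo X \<in> le C D i" using tr oX by (simp add: truncation_def right_adjoint_incl_def)
    then show ?thesis using Y le_mono[OF D True] DT by blast
  next
    case False
    then have "X \<in> le C D i" using X TD le_mono[OF D, of 0 i] by auto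
    then have "iso_arr C (Fo X) X (\<epsilon> X)"
      using counit_iso tr oX unfolding truncation_def by blast
    then show ?thesis using Y le_iso[OF T X] iso_arr_sym by blast
  qed
qed

end

theorem corollary6p15:
  fixes C :: "('o, 'm) triangulated_category"
    and D T :: "'o tpair"
    and n :: nat
  assumes "triangulated_category C"
    and "t_structure C D"
    and "t_structure C T"
    and "tilting_pair C n D T"
  shows "left_compatible C D T \<longleftrightarrow> n = 0 \<or> n = 1"
proof -
  interpret triangulated_category C by fact
  note D = \<open>t_structure C D\<close> and T = \<open>t_structure C T\<close>
  have TD: "le C T 0 \<subseteq> le C D 0" and n: "le C D (- int n) \<subseteq> le C T 0"
    and n_min: "\<And>m. le C D (- int m) \<subseteq> le C T 0 \<Longrightarrow> n \<le> m"
    and cog: "cogenerates C (heart C D \<inter> heart C T) (heart C D)"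
    using assms(4) by (auto simp: tilting_pair_def of_type_def)
  show ?thesis
  proof
    assume lc: "left_compatible C D T"
    have "ShO C 1 X \<in> le C T 0" if X: "X \<in> heart C D" for X
    proof -
      obtain Z E u v w where "Z \<in> le C T 0" "E \<in> ge C D (- 1 + 1)"
        "dist_triangle C (ShO C 1 X) Z E u v w"
        using shifted_heart_truncates_cone[OF D T cog X] by auto
      moreover have "ShO C 1 X \<in> le C D (- 1)"
        using X le_obj[OF D] le_shift_iff[OF D] by (auto simp: heart_def)
      ultimately show ?thesis using left_compatible_truncation_triangle[OF D lc] by blast
    qed
    from le_subset_from_heart[OF D T this n] have "n \<le> 1" using n_min[of 1] by simp
    then show "n = 0 \<or> n = 1" by auto
  next
    assume "n = 0 \<or> n = 1"
    then have "le C D (- 1) \<subseteq> le C T 0" using n le_mono[OF D, of "- 1" "- int n"] by auto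
    then show "left_compatible C D T" using left_compatible_if_near[OF D T TD] by blast
  qed
qed

end
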